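(* Let $(A,D(A))$ be a closed and densely defined operator on a Banach space $X$. Then we have the following. (1) $\sigma_n(A)$ is closed and convex. (2) $\sigma_n(\alpha A+\beta)=\alpha\,\sigma_n(A)+\beta$ for all complex numbers $\alpha$ and $\beta$. (3) $\sigma_n(A)=\sigma_n(U^{-1}AU)$ for all isometric isomorphisms $U$ on $X$.
   Context: For $\theta\in[0,2\pi)$ and $\omega\in\mathbb{R}$ let $H_{\theta,\omega}:=\{e^{i\theta}\lambda:\ \lambda\in\mathbb{C},\ \mathrm{Re}\,\lambda>\omega\}$, an open half plane with boundary $\partial H_{\theta,\omega}$, and let $d(\lambda,\partial H_{\theta,\omega}):=\inf\{|\lambda-z|:z\in\partial H_{\theta,\omega}\}$. For a closed and densely defined operator $(A,D(A))$ on a Banach space $X$ with resolvent set $\rho(A)$ and resolvent $R(\lambda,A)=(\lambda-A)^{-1}$, the numerical resolvent set $\rho_n(A)$ is the union of all open half planes $H_{\theta,\omega}$ such that $H_{\theta,\omega}\subseteq\rho(A)$ and $\|R(\lambda,A)\|\le \frac{1}{d(\lambda,\partial H_{\theta,\omega})}$ for all $\lambda\in H_{\theta,\omega}$. The numerical spectrum of $A$ is the complementary set $\sigma_n(A):=\mathbb{C}\setminus\rho_n(A)$.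
   Formalization: In (2), for α = 0 the operator 0A+β is read as β on all of X (the closure of β on D(A)); with domain D(A) ≠ X it is not closed and has empty resolvent set, so the literal identity fails or is undefined. *)

theory Defs
  imports "HOL-Analysis.Analysis"
begin

class complex_normed_vector = real_normed_vector +
  fixes scaleC :: "complex \<Rightarrow> 'a \<Rightarrow> 'a"  (infixr \<open>*\<^sub>C\<close> 75)
  assumes scaleC_add_right: "a *\<^sub>C (x + y) = a *\<^sub>C x + a *\<^sub>C y"
    and scaleC_add_left: "(a + b) *\<^sub>C x = a *\<^sub>C x + b *\<^sub>C x"
    and scaleC_scaleC: "a *\<^sub>C b *\<^sub>C x = (a * b) *\<^sub>C x"
    and scaleC_of_real: "complex_of_real r *\<^sub>C x = r *\<^sub>R x"
    and norm_scaleC: "norm (a *\<^sub>C x) = cmod a * norm x"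

class complex_banach = complex_normed_vector + banach

interpretation complex_vector:
  vector_space "scaleC :: complex \<Rightarrow> 'a \<Rightarrow> 'a :: complex_normed_vector"
proof
  fix x :: 'a
  show "1 *\<^sub>C x = x"
    using scaleC_of_real[of 1 x] by simp
qed (simp_all add: scaleC_add_right scaleC_add_left scaleC_scaleC)

text \<open>An operator \<open>(A, D(A))\<close> is the pair of its domain and a total function whose values
  outside the domain are irrelevant.\<close>

type_synonym 'a partial_op = "'a set \<times> ('a \<Rightarrow> 'a)"

abbreviation op_dom :: "'a partial_op \<Rightarrow> 'a set"
  where "op_dom A \<equiv> fst A"

abbreviation op_app :: "'a partial_op \<Rightarrow> 'a \<Rightarrow> 'a"
  where "op_app A \<equiv> snd A"

definition linear_op :: "'a::complex_normed_vector partial_op \<Rightarrow> bool"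
  where "linear_op A \<longleftrightarrow>
    complex_vector.subspace (op_dom A) \<and>
    (\<forall>x\<in>op_dom A. \<forall>y\<in>op_dom A. op_app A (x + y) = op_app A x + op_app A y) \<and>
    (\<forall>c. \<forall>x\<in>op_dom A. op_app A (c *\<^sub>C x) = c *\<^sub>C op_app A x)"

definition closed_op :: "'a::complex_normed_vector partial_op \<Rightarrow> bool"
  where "closed_op A \<longleftrightarrow> linear_op A \<and> closed ((\<lambda>x. (x, op_app A x)) ` op_dom A)"

definition densely_defined :: "'a::complex_normed_vector partial_op \<Rightarrow> bool"
  where "densely_defined A \<longleftrightarrow> closure (op_dom A) = UNIV"

definition resolvent :: "complex \<Rightarrow> 'a::complex_normed_vector partial_op \<Rightarrow> 'a \<Rightarrow> 'a"
  where "resolvent l A = inv_into (op_dom A) (\<lambda>x. l *\<^sub>C x - op_app A x)"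

definition resolvent_set :: "'a::complex_normed_vector partial_op \<Rightarrow> complex set"
  where "resolvent_set A =
    {l. bij_betw (\<lambda>x. l *\<^sub>C x - op_app A x) (op_dom A) UNIV \<and> bounded_linear (resolvent l A)}"

definition half_plane :: "real \<Rightarrow> real \<Rightarrow> complex set"
  where "half_plane \<theta> \<omega> = {exp (\<i> * complex_of_real \<theta>) * l | l. Re l > \<omega>}"

definition numerical_resolvent_set :: "'a::complex_normed_vector partial_op \<Rightarrow> complex set"
  where "numerical_resolvent_set A =
    \<Union> {half_plane \<theta> \<omega> | \<theta> \<omega>. \<theta> \<in> {0..<2 * pi} \<and> half_plane \<theta> \<omega> \<subseteq> resolvent_set A \<and>
        (\<forall>l\<in>half_plane \<theta> \<omega>.
          onorm (resolvent l A) \<le> 1 / infdist l (frontier (half_plane \<theta> \<omega>)))}"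

definition numerical_spectrum :: "'a::complex_normed_vector partial_op \<Rightarrow> complex set"
  where "numerical_spectrum A = - numerical_resolvent_set A"

text \<open>The operator \<open>\<alpha>A + \<beta>\<close>. Its domain is \<open>D(A)\<close>, except that \<open>0A + \<beta>\<close> is read as the
  everywhere defined operator \<open>\<beta>\<close>, as usual for a constant polynomial in \<open>A\<close>. On the domain
  \<open>D(A)\<close> the operator \<open>0A + \<beta>\<close> is not closed unless \<open>D(A)\<close> is the whole space; its closure is
  \<open>\<beta>\<close> on the whole space.\<close>

definition affine_op ::
    "complex \<Rightarrow> 'a::complex_normed_vector partial_op \<Rightarrow> complex \<Rightarrow> 'a partial_op"
  where "affine_op \<alpha> A \<beta> =
    (if \<alpha> = 0 then UNIV else op_dom A, \<lambda>x. \<alpha> *\<^sub>C op_app A x + \<beta> *\<^sub>C x)"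

definition isometric_isomorphism :: "('a::complex_normed_vector \<Rightarrow> 'a) \<Rightarrow> bool"
  where "isometric_isomorphism U \<longleftrightarrow>
    Vector_Spaces.linear scaleC scaleC U \<and> bij U \<and> (\<forall>x. norm (U x) = norm x)"

text \<open>The operator \<open>U\<^sup>-\<^sup>1 A U\<close> with its maximal domain.\<close>

definition conjugate_op :: "('a \<Rightarrow> 'a) \<Rightarrow> 'a partial_op \<Rightarrow> 'a partial_op"
  where "conjugate_op U A = (U -` op_dom A, \<lambda>x. inv U (op_app A (U x)))"

end

theory Submission
  imports Defs
begin

text \<open>
  After the half planes are written as \<open>{z. u \<bullet> z > \<omega>}\<close> with a unit vector \<open>u\<close>, the distance of
  \<open>l\<close> to the boundary is \<open>u \<bullet> l - \<omega>\<close>, and the resolvent estimate says that \<open>l - A\<close> is a bijection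
  with \<open>(u \<bullet> l - \<omega>) * norm x \<le> norm (l x - A x)\<close>. So \<open>\<sigma>\<^sub>n(A)\<close> is an intersection of
  closed half planes, hence closed and convex. The condition on \<open>l - A\<close> does not mention inverses,
  so it transfers at once along \<open>A \<mapsto> \<alpha>A + \<beta>\<close> with \<open>\<alpha> \<noteq> 0\<close>, which moves and dilates
  half planes, and along isometric conjugation, which leaves them in place. As both
  transformations have inverses of the same kind, inclusions suffice.

  The case \<open>\<alpha> = 0\<close> is different. If the space is not trivial, then \<open>\<sigma>\<^sub>n(\<beta>) = {\<beta>}\<close>, while the
  image of \<open>\<sigma>\<^sub>n(A)\<close> under a constant map is \<open>{\<beta>}\<close> only if \<open>\<sigma>\<^sub>n(A)\<close> is not empty. So a point
  of \<open>\<sigma>\<^sub>n(A)\<close> is needed (\<open>numerical_spectrum_nonempty\<close>), and every value of the numerical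
  range is one: if a functional \<open>j\<close> of norm one has \<open>j(x) = norm x\<close> with \<open>x \<noteq> 0\<close> in the domain,
  then \<open>j(A x) / norm x\<close> belongs to \<open>\<sigma>\<^sub>n(A)\<close>. Only the number \<open>j(A x)\<close> matters, and it can be found
  in the plane: its conjugate is a subgradient \<open>c\<close> at \<open>0\<close> of the convex function
  \<open>w \<mapsto> norm (x + w A x)\<close> of a complex variable, and any such subgradient will do.
  Indeed, if a half plane of the numerical resolvent set has normal \<open>u\<close>, the Yosida approximations
  \<open>s u R(s u) A x\<close> tend to \<open>A x\<close> as \<open>s \<rightarrow> \<infinity>\<close>, because the domain is dense. Together with
  \<open>norm (s u R(s u)) \<le> s / (s - \<omega>)\<close> this bounds the growth of the norm at \<open>x\<close> in the direction
  \<open>cnj u A x\<close> by \<open>\<omega> * norm x\<close>, so \<open>cnj c / norm x\<close> lies outside the half plane.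
\<close>

section \<open>Half planes as half spaces\<close>

lemma half_plane_eq_halfspace: "half_plane \<theta> \<omega> = {z. cis \<theta> \<bullet> z > \<omega>}"
proof (intro equalityI subsetI)
  fix z assume "z \<in> half_plane \<theta> \<omega>"
  then obtain l where l: "z = cis \<theta> * l" "Re l > \<omega>"
    by (auto simp: half_plane_def cis_conv_exp)
  have "cis \<theta> \<bullet> z = Re l * (cos \<theta> * cos \<theta>) + Re l * (sin \<theta> * sin \<theta>)"
    unfolding l by (simp add: inner_complex_def algebra_simps)
  then have "cis \<theta> \<bullet> z = Re l"
    by (simp only: distrib_left[symmetric] sin_cos_squared_add3 mult_1_right)
  with l show "z \<in> {z. cis \<theta> \<bullet> z > \<omega>}" by simp
next
  fix z assume "z \<in> {z. cis \<theta> \<bullet> z > \<omega>}"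
  then have "Re (cis (- \<theta>) * z) > \<omega>" by (simp add: inner_complex_def)
  moreover have "z = cis \<theta> * (cis (- \<theta>) * z)"
    by (simp add: mult.assoc[symmetric] cis_mult)
  ultimately show "z \<in> half_plane \<theta> \<omega>"
    unfolding half_plane_def cis_conv_exp[symmetric] by blast
qed

lemma infdist_frontier_halfspace:
  fixes u l :: "'a::euclidean_space"
  assumes u: "norm u = 1" and l: "u \<bullet> l > \<omega>"
  shows "infdist l (frontier {z. u \<bullet> z > \<omega>}) = u \<bullet> l - \<omega>"
proof -
  have fr: "frontier {z. u \<bullet> z > \<omega>} = {z. u \<bullet> z = \<omega>}"
    using u by (intro frontier_halfspace_gt) auto
  let ?p = "l - (u \<bullet> l - \<omega>) *\<^sub>R u"
  have p: "?p \<in> {z. u \<bullet> z = \<omega>}"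
    using u by (simp add: inner_diff_right norm_eq_1)
  have "infdist l {z. u \<bullet> z = \<omega>} \<le> dist l ?p"
    using p by (rule infdist_le)
  also have "dist l ?p = u \<bullet> l - \<omega>"
    using u l by (simp add: dist_norm)
  finally have le: "infdist l {z. u \<bullet> z = \<omega>} \<le> u \<bullet> l - \<omega>" .
  have "u \<bullet> l - \<omega> \<le> dist l z" if "u \<bullet> z = \<omega>" for z
    using norm_cauchy_schwarz[of u "l - z"] u that by (simp add: dist_norm inner_diff_right)
  then have "u \<bullet> l - \<omega> \<le> infdist l {z. u \<bullet> z = \<omega>}"
    using p by (auto simp: infdist_def intro!: cINF_greatest)
  with le fr show ?thesis by simp
qed

lemma unit_complex_eq_cis:
  assumes "norm u = 1"
  obtains \<theta> where "\<theta> \<in> {0..<2 * pi}" "u = cis \<theta>"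
proof -
  from complex_unit_circle[of u] have "(Re u)\<^sup>2 + (Im u)\<^sup>2 = 1"
    using assms by (simp add: cmod_power2[symmetric])
  then obtain t where "0 \<le> t" "t < 2 * pi" "Re u = cos t" "Im u = sin t"
    by (rule sincos_total_2pi)
  then show ?thesis by (intro that[of t]) (auto simp: complex_eq_iff)
qed

section \<open>Half spaces of the numerical resolvent set\<close>

lemma linear_opD:
  assumes "linear_op A"
  shows "0 \<in> op_dom A" "x \<in> op_dom A \<Longrightarrow> y \<in> op_dom A \<Longrightarrow> x + y \<in> op_dom A"
    "x \<in> op_dom A \<Longrightarrow> y \<in> op_dom A \<Longrightarrow> x - y \<in> op_dom A"
    "x \<in> op_dom A \<Longrightarrow> c *\<^sub>C x \<in> op_dom A"
    "x \<in> op_dom A \<Longrightarrow> y \<in> op_dom A \<Longrightarrow> op_app A (x + y) = op_app A x + op_app A y"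
    "x \<in> op_dom A \<Longrightarrow> y \<in> op_dom A \<Longrightarrow> op_app A (x - y) = op_app A x - op_app A y"
    "x \<in> op_dom A \<Longrightarrow> op_app A (c *\<^sub>C x) = c *\<^sub>C op_app A x"
proof -
  have S: "complex_vector.subspace (op_dom A)" using assms by (simp add: linear_op_def)
  note sub = complex_vector.subspace_0[OF S] complex_vector.subspace_add[OF S]
    complex_vector.subspace_diff[OF S] complex_vector.subspace_scale[OF S]
  note add = assms[unfolded linear_op_def, THEN conjunct2, THEN conjunct1, rule_format]
  note sc = assms[unfolded linear_op_def, THEN conjunct2, THEN conjunct2, rule_format]
  show "0 \<in> op_dom A" "x \<in> op_dom A \<Longrightarrow> y \<in> op_dom A \<Longrightarrow> x + y \<in> op_dom A"
    "x \<in> op_dom A \<Longrightarrow> y \<in> op_dom A \<Longrightarrow> x - y \<in> op_dom A"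
    "x \<in> op_dom A \<Longrightarrow> c *\<^sub>C x \<in> op_dom A"
    "x \<in> op_dom A \<Longrightarrow> y \<in> op_dom A \<Longrightarrow> op_app A (x + y) = op_app A x + op_app A y"
    "x \<in> op_dom A \<Longrightarrow> op_app A (c *\<^sub>C x) = c *\<^sub>C op_app A x"
    using sub add sc by auto
  assume x: "x \<in> op_dom A" and y: "y \<in> op_dom A"
  show "op_app A (x - y) = op_app A x - op_app A y"
    using add[of "x - y" y] sub(3)[OF x y] y by simp
qed

text \<open>The resolvent enters the numerical resolvent set only through its existence and its norm.
  Both can be read off from \<open>l - A\<close>: a bijection that is bounded below has a bounded inverse,
  which is linear because \<open>A\<close> is.\<close>

lemma resolvent_bound_iff:
  fixes A :: "'a::complex_normed_vector partial_op"
  assumes A: "linear_op A" and c: "0 \<le> c"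
  shows "l \<in> resolvent_set A \<and> onorm (resolvent l A) \<le> c \<longleftrightarrow>
    bij_betw (\<lambda>x. l *\<^sub>C x - op_app A x) (op_dom A) UNIV \<and>
    (\<forall>x\<in>op_dom A. norm x \<le> c * norm (l *\<^sub>C x - op_app A x))"
    (is "?L \<longleftrightarrow> ?bij \<and> ?bound")
proof -
  let ?f = "\<lambda>x. l *\<^sub>C x - op_app A x"
  have inv: "resolvent l A (?f x) = x" if ?bij "x \<in> op_dom A" for x
    using that unfolding resolvent_def bij_betw_def by (blast intro: inv_into_f_f)
  have onto: "\<exists>x\<in>op_dom A. y = ?f x" if ?bij for y
    using that unfolding bij_betw_def by (blast dest: equalityD2[THEN subsetD])
  show ?thesis
  proof
    assume L: ?L
    then have bij: ?bij and bl: "bounded_linear (resolvent l A)"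
      by (auto simp: resolvent_set_def)
    have "norm x \<le> c * norm (?f x)" if "x \<in> op_dom A" for x
    proof -
      have "norm x = norm (resolvent l A (?f x))" using inv[OF bij that] by simp
      also have "\<dots> \<le> onorm (resolvent l A) * norm (?f x)" by (rule onorm[OF bl])
      also have "\<dots> \<le> c * norm (?f x)" using L by (intro mult_right_mono) auto
      finally show ?thesis .
    qed
    with bij show "?bij \<and> ?bound" by blast
  next
    assume R: "?bij \<and> ?bound"
    then have bij: ?bij by blast
    have bd: "norm (resolvent l A y) \<le> c * norm y" for y
      using onto[OF bij, of y] inv[OF bij] R by auto
    have add: "resolvent l A (y + z) = resolvent l A y + resolvent l A z" for y z
    proof -
      obtain a b where ab: "a \<in> op_dom A" "b \<in> op_dom A" "y = ?f a" "z = ?f b"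
        using onto[OF bij] by meson
      have "y + z = ?f (a + b)"
        using ab linear_opD[OF A] by (simp add: scaleC_add_right)
      then show ?thesis
        using ab linear_opD(2)[OF A, of a b] by (simp only: inv[OF bij])
    qed
    have scale: "resolvent l A (r *\<^sub>R y) = r *\<^sub>R resolvent l A y" for r y
    proof -
      obtain a where a: "a \<in> op_dom A" "y = ?f a"
        using onto[OF bij] by meson
      have "r *\<^sub>R y = ?f (complex_of_real r *\<^sub>C a)"
        using a linear_opD[OF A]
        by (simp add: scaleC_of_real[symmetric] complex_vector.scale_right_diff_distrib
            scaleC_scaleC mult.commute)
      then have "resolvent l A (r *\<^sub>R y) = complex_of_real r *\<^sub>C a"
        using inv[OF bij linear_opD(4)[OF A a(1)]] by simp
      then show ?thesis
        using inv[OF bij a(1)] a(2) by (simp add: scaleC_of_real)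
    qed
    have "bounded_linear (resolvent l A)"
      using bd by (intro bounded_linear_intro[where K = c] add scale) (simp add: mult.commute)
    moreover have "onorm (resolvent l A) \<le> c" using c bd by (rule onorm_bound)
    ultimately show ?L using bij by (simp add: resolvent_set_def)
  qed
qed

text \<open>The estimate is multiplied out, so that neither the inverse of \<open>l - A\<close> nor a quotient has to be
  carried through transformations of \<open>A\<close>. The vector \<open>u\<close> stands for \<open>cis \<theta>\<close>, without the choice
  of an angle.\<close>

definition numerical_halfspace ::
    "complex \<Rightarrow> real \<Rightarrow> 'a::complex_normed_vector partial_op \<Rightarrow> bool"
  where "numerical_halfspace u \<omega> A \<longleftrightarrow> (\<forall>l. u \<bullet> l > \<omega> \<longrightarrow>
    bij_betw (\<lambda>x. l *\<^sub>C x - op_app A x) (op_dom A) UNIV \<and>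
    (\<forall>x\<in>op_dom A. (u \<bullet> l - \<omega>) * norm x \<le> norm (l *\<^sub>C x - op_app A x)))"

lemma numerical_halfspace_iff:
  assumes A: "linear_op A"
  shows "half_plane \<theta> \<omega> \<subseteq> resolvent_set A \<and>
      (\<forall>l\<in>half_plane \<theta> \<omega>.
        onorm (resolvent l A) \<le> 1 / infdist l (frontier (half_plane \<theta> \<omega>))) \<longleftrightarrow>
    numerical_halfspace (cis \<theta>) \<omega> A"
proof -
  have "(l \<in> resolvent_set A \<and>
        onorm (resolvent l A) \<le> 1 / infdist l (frontier (half_plane \<theta> \<omega>))) \<longleftrightarrow>
      (bij_betw (\<lambda>x. l *\<^sub>C x - op_app A x) (op_dom A) UNIV \<and>
      (\<forall>x\<in>op_dom A. (cis \<theta> \<bullet> l - \<omega>) * norm x \<le> norm (l *\<^sub>C x - op_app A x)))"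
    if "l \<in> half_plane \<theta> \<omega>" for l
  proof -
    have l: "cis \<theta> \<bullet> l > \<omega>" using that by (simp add: half_plane_eq_halfspace)
    have d: "infdist l (frontier (half_plane \<theta> \<omega>)) = cis \<theta> \<bullet> l - \<omega>"
      unfolding half_plane_eq_halfspace using l by (intro infdist_frontier_halfspace) simp_all
    show ?thesis
      unfolding d using l
      by (subst resolvent_bound_iff[OF A]) (auto simp: field_simps)
  qed
  then show ?thesis
    unfolding numerical_halfspace_def by (auto simp: half_plane_eq_halfspace)
qed

lemma numerical_resolvent_set_eq:
  assumes A: "linear_op A"
  shows "numerical_resolvent_set A =
    {z. \<exists>u \<omega>. norm u = 1 \<and> numerical_halfspace u \<omega> A \<and> u \<bullet> z > \<omega>}"
proof (intro equalityI subsetI)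
  fix z assume "z \<in> numerical_resolvent_set A"
  then obtain \<theta> \<omega> where "z \<in> half_plane \<theta> \<omega>" "numerical_halfspace (cis \<theta>) \<omega> A"
    unfolding numerical_resolvent_set_def numerical_halfspace_iff[OF A, symmetric] by blast
  then show "z \<in> {z. \<exists>u \<omega>. norm u = 1 \<and> numerical_halfspace u \<omega> A \<and> u \<bullet> z > \<omega>}"
    by (auto simp: half_plane_eq_halfspace intro!: exI[of _ "cis \<theta>"])
next
  fix z assume "z \<in> {z. \<exists>u \<omega>. norm u = 1 \<and> numerical_halfspace u \<omega> A \<and> u \<bullet> z > \<omega>}"
  then obtain u \<omega> where u: "norm u = 1" "numerical_halfspace u \<omega> A" "u \<bullet> z > \<omega>" by blast
  obtain \<theta> where t: "\<theta> \<in> {0..<2 * pi}" "u = cis \<theta>" using u(1) by (rule unit_complex_eq_cis)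
  have "z \<in> half_plane \<theta> \<omega>" using u t by (simp add: half_plane_eq_halfspace)
  then show "z \<in> numerical_resolvent_set A"
    using u(2) t numerical_halfspace_iff[OF A, of \<theta> \<omega>]
    unfolding numerical_resolvent_set_def by blast
qed

lemma numerical_spectrum_eq_Inter:
  assumes "linear_op A"
  shows "numerical_spectrum A =
    (\<Inter>(u, \<omega>)\<in>{(u, \<omega>). norm u = 1 \<and> numerical_halfspace u \<omega> A}. {z. u \<bullet> z \<le> \<omega>})"
  unfolding numerical_spectrum_def numerical_resolvent_set_eq[OF assms]
  by (auto simp: not_less)

lemma closed_numerical_spectrum:
  assumes "linear_op A"
  shows "closed (numerical_spectrum A)"
  unfolding numerical_spectrum_eq_Inter[OF assms]
  by (intro closed_INT) (auto simp: closed_halfspace_le)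

lemma convex_numerical_spectrum:
  assumes "linear_op A"
  shows "convex (numerical_spectrum A)"
  unfolding numerical_spectrum_eq_Inter[OF assms]
  by (intro convex_INT) (auto simp: convex_halfspace_le)

section \<open>Affine transformations\<close>

lemma linear_affine_op:
  assumes A: "linear_op A"
  shows "linear_op (affine_op \<alpha> A \<beta>)"
proof -
  have "complex_vector.subspace (op_dom A)" using A by (simp add: linear_op_def)
  then have "complex_vector.subspace (op_dom (affine_op \<alpha> A \<beta>))"
    by (simp add: affine_op_def complex_vector.subspace_UNIV)
  then show ?thesis
    using linear_opD[OF A] unfolding linear_op_def
    by (auto simp: affine_op_def scaleC_add_right scaleC_scaleC mult.commute)
qed

lemma affine_op_inverse:
  assumes "\<alpha> \<noteq> 0"
  shows "affine_op (inverse \<alpha>) (affine_op \<alpha> A \<beta>) (- (\<beta> / \<alpha>)) = A"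
  using assms
  by (simp add: affine_op_def scaleC_add_right scaleC_scaleC divide_inverse mult.commute prod_eq_iff)

lemma bij_scaleC:
  assumes "\<alpha> \<noteq> 0"
  shows "bij (\<lambda>x::'a::complex_normed_vector. \<alpha> *\<^sub>C x)"
  by (rule bij_betw_byWitness[where f' = "\<lambda>x. inverse \<alpha> *\<^sub>C x"])
    (use assms in \<open>auto simp: scaleC_scaleC\<close>)

text \<open>Multiplication by \<open>\<alpha>\<close> rotates by \<open>sgn \<alpha>\<close> and dilates by \<open>cmod \<alpha>\<close>; rotating the normal vector
  along leaves only the dilation.\<close>

lemma inner_mult_sgn:
  fixes \<alpha> u z :: complex
  shows "(sgn \<alpha> * u) \<bullet> (\<alpha> * z) = cmod \<alpha> * (u \<bullet> z)"
proof (cases "\<alpha> = 0")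
  case False
  have "(sgn \<alpha> * u) \<bullet> (\<alpha> * z) = ((Re \<alpha>)\<^sup>2 + (Im \<alpha>)\<^sup>2) / cmod \<alpha> * (u \<bullet> z)"
    using False
    by (simp add: inner_complex_def sgn_eq field_simps power2_eq_square)
  also have "\<dots> = (cmod \<alpha>)\<^sup>2 / cmod \<alpha> * (u \<bullet> z)"
    by (simp only: cmod_power2)
  also have "\<dots> = cmod \<alpha> * (u \<bullet> z)"
    by (simp add: power2_eq_square)
  finally show ?thesis .
qed simp

text \<open>With \<open>l = \<alpha> m + \<beta>\<close> one has \<open>l - (\<alpha>A + \<beta>) = \<alpha>(m - A)\<close>, so norms grow by the factor
  \<open>cmod \<alpha>\<close>; so does the distance to the boundary of the half plane.\<close>

lemma numerical_halfspace_affine_op: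
  assumes \<alpha>: "\<alpha> \<noteq> 0" and H: "numerical_halfspace u \<omega> A"
  shows "numerical_halfspace (sgn \<alpha> * u) (cmod \<alpha> * \<omega> + (sgn \<alpha> * u) \<bullet> \<beta>) (affine_op \<alpha> A \<beta>)"
  unfolding numerical_halfspace_def
proof (intro allI impI)
  fix l assume l: "(sgn \<alpha> * u) \<bullet> l > cmod \<alpha> * \<omega> + (sgn \<alpha> * u) \<bullet> \<beta>"
  define m where "m = (l - \<beta>) / \<alpha>"
  have lm: "l = \<alpha> * m + \<beta>" using \<alpha> by (simp add: m_def)
  have d: "(sgn \<alpha> * u) \<bullet> l - (cmod \<alpha> * \<omega> + (sgn \<alpha> * u) \<bullet> \<beta>) = cmod \<alpha> * (u \<bullet> m - \<omega>)"
    by (simp add: lm inner_add_right inner_mult_sgn right_diff_distrib)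
  with l \<alpha> have "u \<bullet> m > \<omega>"
    by (metis diff_gt_0_iff_gt zero_less_mult_pos zero_less_norm_iff)
  with H have bij: "bij_betw (\<lambda>x. m *\<^sub>C x - op_app A x) (op_dom A) UNIV"
    and bd: "\<And>x. x \<in> op_dom A \<Longrightarrow> (u \<bullet> m - \<omega>) * norm x \<le> norm (m *\<^sub>C x - op_app A x)"
    by (auto simp: numerical_halfspace_def)
  have eq: "l *\<^sub>C x - op_app (affine_op \<alpha> A \<beta>) x = \<alpha> *\<^sub>C (m *\<^sub>C x - op_app A x)" for x
    by (simp add: lm affine_op_def scaleC_add_left complex_vector.scale_right_diff_distrib
        scaleC_scaleC)
  have dom: "op_dom (affine_op \<alpha> A \<beta>) = op_dom A" using \<alpha> by (simp add: affine_op_def)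
  show "bij_betw (\<lambda>x. l *\<^sub>C x - op_app (affine_op \<alpha> A \<beta>) x) (op_dom (affine_op \<alpha> A \<beta>)) UNIV \<and>
    (\<forall>x\<in>op_dom (affine_op \<alpha> A \<beta>).
      ((sgn \<alpha> * u) \<bullet> l - (cmod \<alpha> * \<omega> + (sgn \<alpha> * u) \<bullet> \<beta>)) * norm x
      \<le> norm (l *\<^sub>C x - op_app (affine_op \<alpha> A \<beta>) x))"
    unfolding d dom eq
    using bij_betw_trans[OF bij bij_scaleC[OF \<alpha>]] bd
    by (auto simp: o_def norm_scaleC mult.assoc intro!: mult_left_mono)
qed

lemma numerical_resolvent_set_affine_op_superset:
  assumes A: "linear_op A" and \<alpha>: "\<alpha> \<noteq> 0" and z: "z \<in> numerical_resolvent_set A"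
  shows "\<alpha> * z + \<beta> \<in> numerical_resolvent_set (affine_op \<alpha> A \<beta>)"
proof -
  obtain u \<omega> where u: "norm u = 1" "numerical_halfspace u \<omega> A" "u \<bullet> z > \<omega>"
    using z unfolding numerical_resolvent_set_eq[OF A] by blast
  have "norm (sgn \<alpha> * u) = 1" using \<alpha> u by (simp add: norm_mult norm_sgn)
  moreover have "(sgn \<alpha> * u) \<bullet> (\<alpha> * z + \<beta>) > cmod \<alpha> * \<omega> + (sgn \<alpha> * u) \<bullet> \<beta>"
    using u \<alpha> by (simp add: inner_add_right inner_mult_sgn)
  ultimately show ?thesis
    unfolding numerical_resolvent_set_eq[OF linear_affine_op[OF A]]
    using numerical_halfspace_affine_op[OF \<alpha> u(2)] by blast
qed

lemma numerical_spectrum_affine_op: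
  assumes A: "linear_op A" and \<alpha>: "\<alpha> \<noteq> 0"
  shows "numerical_spectrum (affine_op \<alpha> A \<beta>) = (\<lambda>z. \<alpha> * z + \<beta>) ` numerical_spectrum A"
proof -
  have "\<alpha> * z + \<beta> \<in> numerical_resolvent_set (affine_op \<alpha> A \<beta>) \<longleftrightarrow>
      z \<in> numerical_resolvent_set A" for z
  proof
    assume "\<alpha> * z + \<beta> \<in> numerical_resolvent_set (affine_op \<alpha> A \<beta>)"
    from numerical_resolvent_set_affine_op_superset[OF linear_affine_op[OF A] _ this,
        of "inverse \<alpha>" "- (\<beta> / \<alpha>)"]
    have "inverse \<alpha> * (\<alpha> * z + \<beta>) + - (\<beta> / \<alpha>) \<in> numerical_resolvent_set A"
      using \<alpha> by (simp add: affine_op_inverse)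
    also have "inverse \<alpha> * (\<alpha> * z + \<beta>) + - (\<beta> / \<alpha>) = z"
      using \<alpha> by (simp add: field_simps)
    finally show "z \<in> numerical_resolvent_set A" .
  qed (rule numerical_resolvent_set_affine_op_superset[OF A \<alpha>])
  from this[of "(w - \<beta>) / \<alpha>" for w] have "w \<in> numerical_spectrum (affine_op \<alpha> A \<beta>) \<longleftrightarrow>
      (w - \<beta>) / \<alpha> \<in> numerical_spectrum A" for w
    using \<alpha> by (simp add: numerical_spectrum_def)
  moreover have "w \<in> (\<lambda>z. \<alpha> * z + \<beta>) ` S \<longleftrightarrow> (w - \<beta>) / \<alpha> \<in> S" for w S
    using \<alpha> by (auto simp: image_iff intro: bexI[of _ "(w - \<beta>) / \<alpha>"])
  ultimately show ?thesis by blast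
qed

section \<open>The numerical spectrum is not empty\<close>

text \<open>A hyperplane that separates \<open>(a, g a)\<close> from the strict epigraph of \<open>g\<close> cannot be vertical,
  since the epigraph lies over the whole space; its slope is the subgradient.\<close>

lemma convex_on_real_subgradient:
  fixes g :: "'a::euclidean_space \<Rightarrow> real"
  assumes g: "convex_on UNIV g"
  obtains c where "\<And>w. g w \<ge> g a + c \<bullet> (w - a)"
proof -
  let ?E = "{p :: 'a \<times> real. g (fst p) < snd p}"
  have "convex ?E"
  proof (rule convexI)
    fix p q :: "'a \<times> real" and s t :: real
    assume pq: "p \<in> ?E" "q \<in> ?E" and st: "0 \<le> s" "0 \<le> t" "s + t = 1"
    have "g (s *\<^sub>R fst p + t *\<^sub>R fst q) \<le> s * g (fst p) + t * g (fst q)"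
      using g st by (auto simp: convex_on_def)
    also have "\<dots> < s * snd p + t * snd q"
    proof (cases "s = 0")
      case False
      then show ?thesis
        using pq st by (intro add_less_le_mono mult_strict_left_mono mult_left_mono) auto
    qed (use pq st in auto)
    finally show "s *\<^sub>R p + t *\<^sub>R q \<in> ?E" by simp
  qed
  moreover have "(a, g a + 1) \<in> ?E" by simp
  then have "?E \<noteq> {}" by blast
  ultimately obtain d b where d: "d \<noteq> 0" "d \<bullet> (a, g a) \<le> b" "\<And>p. p \<in> ?E \<Longrightarrow> d \<bullet> p \<ge> b"
    using separating_hyperplane_sets[of "{(a, g a)}" ?E] by auto
  obtain v s where vs: "d = (v, s)" by (cases d)
  have sep: "v \<bullet> (w - a) + s * (r - g a) \<ge> 0" if "g w < r" for w r
    using d(2) d(3)[of "(w, r)"] that by (simp add: vs algebra_simps inner_diff_right)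
  have s0: "s \<ge> 0" using sep[of a "g a + 1"] by simp
  have "s \<noteq> 0"
  proof
    assume "s = 0"
    then have "v \<bullet> (w - a) \<ge> 0" for w using sep[of w "g w + 1"] by simp
    from this[of "a - v"] have "v \<bullet> v \<le> 0" by simp
    then have "v = 0" using inner_gt_zero_iff[of v] by linarith
    with \<open>s = 0\<close> d(1) vs show False by (simp add: zero_prod_def)
  qed
  with s0 have s: "s > 0" by simp
  have "g a + (- (1 / s) *\<^sub>R v) \<bullet> (w - a) \<le> g w" for w
  proof (rule dense_ge)
    fix r assume "g w < r"
    from sep[OF this] s show "g a + (- (1 / s) *\<^sub>R v) \<bullet> (w - a) \<le> r"
      by (simp add: field_simps)
  qed
  then show ?thesis by (rule that)
qed

text \<open>Put \<open>l = s u\<close> and \<open>y = l R(l) x\<close>. Then \<open>y = x + (cnj u / s) k\<close> with the Yosida approximation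
  \<open>k = l R(l) A x\<close> of \<open>A x\<close>. The norm of \<open>y\<close> gives the first term of the bound; the second one
  is the error from replacing \<open>k\<close> by \<open>A x\<close>, which is estimated by comparing both with a vector
  \<open>v\<close> of the domain near \<open>A x\<close>: here \<open>(l - A)(k - v) = l (A x - v) + A v\<close>.\<close>

lemma numerical_halfspace_tangent_bound:
  fixes A :: "'a::complex_normed_vector partial_op"
  assumes A: "linear_op A" and H: "numerical_halfspace u \<omega> A" and u: "norm u = 1"
    and x: "x \<in> op_dom A" and v: "v \<in> op_dom A" and s: "s > 0" "s > \<omega>"
  shows "norm (x + (cnj u / s) *\<^sub>C op_app A x) \<le> s / (s - \<omega>) * norm x +
    ((s * norm (op_app A x - v) + norm (op_app A v)) / (s - \<omega>) + norm (op_app A x - v)) / s"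
proof -
  define l where "l = complex_of_real s * u"
  have "u \<bullet> u = 1" using u by (simp add: norm_eq_1)
  then have ul: "u \<bullet> l = s"
    by (simp add: l_def flip: scaleR_conv_of_real)
  have nl: "norm l = s" using u s by (simp add: l_def norm_mult)
  have uu: "u * cnj u = 1" using u by (simp add: complex_norm_square[symmetric])
  have l0: "cnj u / s * l = 1" "l * (cnj u / s) = 1"
    using uu s by (simp_all add: l_def mult.commute)
  have bij: "bij_betw (\<lambda>x. l *\<^sub>C x - op_app A x) (op_dom A) UNIV"
    and bd: "\<And>y. y \<in> op_dom A \<Longrightarrow> norm y \<le> norm (l *\<^sub>C y - op_app A y) / (s - \<omega>)"
    using H[unfolded numerical_halfspace_def, rule_format, of l] s ul
    by (auto simp: field_simps)
  obtain y where y: "y \<in> op_dom A" "l *\<^sub>C y - op_app A y = l *\<^sub>C x"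
    using bij unfolding bij_betw_def by (metis (no_types, lifting) UNIV_I imageE)
  define k where "k = l *\<^sub>C (y - x)"
  note sd = complex_vector.scale_right_diff_distrib
  have k: "k \<in> op_dom A" unfolding k_def by (intro linear_opD[OF A] y x)
  have Ak: "op_app A k = l *\<^sub>C (op_app A y - op_app A x)"
    unfolding k_def using linear_opD[OF A] x y by simp
  have "k = op_app A y" using y(2) by (simp add: k_def sd algebra_simps)
  then have "l *\<^sub>C (k - v) - op_app A (k - v) = l *\<^sub>C (op_app A x - v) + op_app A v"
    using Ak linear_opD(6)[OF A k v] by (simp add: sd)
  then have "norm (k - v) \<le> norm (l *\<^sub>C (op_app A x - v) + op_app A v) / (s - \<omega>)"
    using bd[OF linear_opD(3)[OF A k v]] by simp
  also have "\<dots> \<le> (s * norm (op_app A x - v) + norm (op_app A v)) / (s - \<omega>)"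
    using s norm_triangle_ineq[of "l *\<^sub>C (op_app A x - v)" "op_app A v"]
    by (intro divide_right_mono) (simp_all add: norm_scaleC nl)
  finally have kv: "norm (k - v) \<le> (s * norm (op_app A x - v) + norm (op_app A v)) / (s - \<omega>)" .
  have "norm (op_app A x - k) \<le> norm (op_app A x - v) + norm (k - v)"
    using norm_triangle_ineq4[of "op_app A x - v" "k - v"] by simp
  with kv have Axk: "norm (op_app A x - k) \<le>
    (s * norm (op_app A x - v) + norm (op_app A v)) / (s - \<omega>) + norm (op_app A x - v)" by simp
  have "(cnj u / s) *\<^sub>C k = y - x" unfolding k_def scaleC_scaleC l0 by simp
  then have "x + (cnj u / s) *\<^sub>C op_app A x = y + (cnj u / s) *\<^sub>C (op_app A x - k)"
    by (simp add: sd)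
  then have "norm (x + (cnj u / s) *\<^sub>C op_app A x) \<le> norm y + norm (op_app A x - k) / s"
    using norm_triangle_ineq[of y "(cnj u / s) *\<^sub>C (op_app A x - k)"] u s
    by (simp add: norm_scaleC norm_divide)
  moreover have "norm y \<le> s / (s - \<omega>) * norm x"
    using bd[OF y(1)] y(2) by (simp add: norm_scaleC nl)
  moreover have "norm (op_app A x - k) / s \<le>
    ((s * norm (op_app A x - v) + norm (op_app A v)) / (s - \<omega>) + norm (op_app A x - v)) / s"
    using Axk s by (intro divide_right_mono) auto
  ultimately show ?thesis by linarith
qed

text \<open>Insert the bound above in the subgradient inequality at \<open>w = cnj u / s\<close>, multiply by \<open>s\<close> and let
  \<open>s \<rightarrow> \<infinity>\<close>. This gives \<open>\<omega> * norm x\<close> up to twice the distance from \<open>A x\<close> to \<open>v\<close>, which density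
  of the domain makes arbitrarily small.\<close>

lemma subgradient_inner_le:
  fixes A :: "'a::complex_normed_vector partial_op"
  assumes A: "linear_op A" and dense: "densely_defined A"
    and H: "numerical_halfspace u \<omega> A" and u: "norm u = 1" and x: "x \<in> op_dom A"
    and c: "\<And>w. norm (x + w *\<^sub>C op_app A x) \<ge> norm x + c \<bullet> w"
  shows "u \<bullet> cnj c \<le> \<omega> * norm x"
proof (rule field_le_epsilon)
  fix e :: real assume e: "e > 0"
  have "op_app A x \<in> closure (op_dom A)" using dense by (simp add: densely_defined_def)
  then obtain v where v: "v \<in> op_dom A" "dist v (op_app A x) < e / 2"
    using e by (meson closure_approachable half_gt_zero)
  define \<delta> where "\<delta> = norm (op_app A x - v)"
  define N where "N = norm (op_app A v)"
  let ?h = "\<lambda>s. \<omega> * norm x * (s / (s - \<omega>)) + (\<delta> * (s / (s - \<omega>)) + N / (s - \<omega>) + \<delta>)"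
  have "u \<bullet> cnj c \<le> ?h s" if s: "s > max 0 \<omega>" for s
  proof -
    have "u \<bullet> cnj c / s = c \<bullet> (cnj u / s)"
      using s by (simp add: inner_complex_def diff_divide_distrib mult.commute)
    also have "\<dots> \<le> s / (s - \<omega>) * norm x + ((s * \<delta> + N) / (s - \<omega>) + \<delta>) / s - norm x"
      using c[of "cnj u / s"]
        numerical_halfspace_tangent_bound[OF A H u x v(1), of s] s
      by (simp add: \<delta>_def N_def)
    also have "\<dots> = (s / (s - \<omega>) - 1) * norm x + ((s * \<delta> + N) / (s - \<omega>) + \<delta>) / s"
      by (simp add: left_diff_distrib)
    also have "s / (s - \<omega>) - 1 = \<omega> * (s / (s - \<omega>)) / s"
      using s by (simp add: field_simps)
    also have "\<dots> * norm x + ((s * \<delta> + N) / (s - \<omega>) + \<delta>) / s = ?h s / s"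
      by (simp add: add_divide_distrib mult_ac)
    finally show ?thesis using s by (simp add: divide_le_cancel)
  qed
  then have ev: "eventually (\<lambda>s. u \<bullet> cnj c \<le> ?h s) at_top"
    by (intro eventually_at_top_dense[THEN iffD2] exI[of _ "max 0 \<omega>"]) auto
  have shift: "filterlim (\<lambda>s. s - \<omega>) at_top at_top"
    using filterlim_tendsto_add_at_top[OF tendsto_const filterlim_ident, of "- \<omega>"] by simp
  have l2: "((\<lambda>s. K / (s - \<omega>)) \<longlongrightarrow> 0) at_top" for K
    by (intro tendsto_divide_0[OF tendsto_const] filterlim_mono[OF shift at_top_le_at_infinity]) simp
  have "eventually (\<lambda>s. 1 + \<omega> / (s - \<omega>) = s / (s - \<omega>)) at_top"
    using eventually_gt_at_top[of \<omega>] by eventually_elim (simp add: field_simps)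
  moreover have "((\<lambda>s. 1 + \<omega> / (s - \<omega>)) \<longlongrightarrow> 1 + 0) at_top"
    by (intro tendsto_intros l2)
  ultimately have l1: "((\<lambda>s. s / (s - \<omega>)) \<longlongrightarrow> 1) at_top"
    by (auto dest: Lim_transform_eventually)
  have "(?h \<longlongrightarrow> \<omega> * norm x * 1 + (\<delta> * 1 + 0 + \<delta>)) at_top"
    by (intro tendsto_intros l1 l2)
  from tendsto_lowerbound[OF this ev]
  have "u \<bullet> cnj c \<le> \<omega> * norm x + 2 * \<delta>" by simp
  moreover have "\<delta> < e / 2" using v by (simp add: \<delta>_def dist_norm norm_minus_commute)
  ultimately show "u \<bullet> cnj c \<le> \<omega> * norm x + e" by simp
qed

lemma numerical_spectrum_nonempty:
  fixes A :: "'a::complex_normed_vector partial_op"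
  assumes A: "linear_op A" and dense: "densely_defined A" and nontriv: "\<exists>x::'a. x \<noteq> 0"
  shows "numerical_spectrum A \<noteq> {}"
proof -
  have "\<not> op_dom A \<subseteq> {0}"
  proof
    assume "op_dom A \<subseteq> {0}"
    then have "closure (op_dom A) \<subseteq> {0}" by (intro closure_minimal) auto
    with dense nontriv show False by (auto simp: densely_defined_def)
  qed
  then obtain x where x: "x \<in> op_dom A" "x \<noteq> 0" by blast
  let ?g = "\<lambda>w. norm (x + w *\<^sub>C op_app A x)"
  have "convex_on UNIV ?g"
  proof (rule convex_onI)
    fix t :: real and w z :: complex assume t: "0 < t" "t < 1"
    have "x + ((1 - t) *\<^sub>R w + t *\<^sub>R z) *\<^sub>C op_app A x =
        (1 - t) *\<^sub>R (x + w *\<^sub>C op_app A x) + t *\<^sub>R (x + z *\<^sub>C op_app A x)"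
      by (simp add: scaleC_add_left scaleC_of_real[symmetric] scaleR_conv_of_real scaleC_add_right
          scaleC_scaleC complex_vector.scale_left_diff_distrib algebra_simps)
    then show "?g ((1 - t) *\<^sub>R w + t *\<^sub>R z) \<le> (1 - t) * ?g w + t * ?g z"
      using t norm_triangle_ineq[of "(1 - t) *\<^sub>R (x + w *\<^sub>C op_app A x)"
          "t *\<^sub>R (x + z *\<^sub>C op_app A x)"] by simp
  qed simp
  then obtain c where c: "\<And>w. ?g w \<ge> ?g 0 + c \<bullet> (w - 0)"
    using convex_on_real_subgradient[of ?g 0] by blast
  have c': "?g w \<ge> norm x + c \<bullet> w" for w using c[of w] by simp
  have "u \<bullet> (cnj c /\<^sub>R norm x) \<le> \<omega>" if "norm u = 1" "numerical_halfspace u \<omega> A" for u \<omega>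
    using subgradient_inner_le[OF A dense that(2,1) x(1), of c] c' x(2)
    by (simp add: field_simps)
  then have "cnj c /\<^sub>R norm x \<in> numerical_spectrum A"
    unfolding numerical_spectrum_eq_Inter[OF A] by auto
  then show ?thesis by blast
qed

text \<open>On the zero space every half plane satisfies the condition.\<close>

lemma numerical_spectrum_trivial:
  fixes A :: "'a::complex_normed_vector partial_op"
  assumes A: "linear_op A" and triv: "\<And>x::'a. x = 0"
  shows "numerical_spectrum A = {}"
proof -
  have U: "UNIV = {0::'a}" using triv by blast
  have "op_dom A = {0}" using linear_opD(1)[OF A] triv by blast
  then have "numerical_halfspace 1 \<omega> A" for \<omega>
    unfolding numerical_halfspace_def U bij_betw_def using triv by auto
  then have "z \<in> numerical_resolvent_set A" for z
    unfolding numerical_resolvent_set_eq[OF A]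
    by (intro CollectI exI[of _ 1] exI[of _ "Re z - 1"]) (simp add: inner_complex_def)
  then show ?thesis by (auto simp: numerical_spectrum_def)
qed

text \<open>A point \<open>z \<noteq> \<beta>\<close> lies in the half plane whose boundary passes through \<open>\<beta>\<close> orthogonally to
  \<open>z - \<beta>\<close>; there \<open>cmod (l - \<beta>)\<close> is at least the distance to the boundary. At \<open>\<beta>\<close> itself the operator
  \<open>l - \<beta>\<close> vanishes and is not injective.\<close>

lemma numerical_spectrum_scalar:
  fixes A :: "'a::complex_normed_vector partial_op"
  assumes A: "linear_op A" and nontriv: "\<exists>x::'a. x \<noteq> 0"
  shows "numerical_spectrum (affine_op 0 A \<beta>) = {\<beta>}"
proof -
  have op: "affine_op 0 A \<beta> = (UNIV, \<lambda>x. \<beta> *\<^sub>C x)" by (simp add: affine_op_def)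
  have diff: "l *\<^sub>C x - \<beta> *\<^sub>C x = (l - \<beta>) *\<^sub>C x" for l and x :: 'a
    by (simp add: complex_vector.scale_left_diff_distrib)
  note lin = linear_affine_op[OF A, of 0 \<beta>]
  have "u \<bullet> \<beta> \<le> \<omega>" if "numerical_halfspace u \<omega> (affine_op 0 A \<beta>)" for u \<omega>
  proof (rule ccontr)
    assume "\<not> u \<bullet> \<beta> \<le> \<omega>"
    with that have "bij (\<lambda>x::'a. (\<beta> - \<beta>) *\<^sub>C x)"
      unfolding numerical_halfspace_def op fst_conv snd_conv diff by (blast intro: not_le_imp_less)
    then have inj: "inj (\<lambda>x::'a. (\<beta> - \<beta>) *\<^sub>C x)" by (rule bij_is_inj)
    have "x = 0" for x :: 'a using injD[OF inj, of x 0] by simp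
    with nontriv show False by blast
  qed
  then have 1: "\<beta> \<in> numerical_spectrum (affine_op 0 A \<beta>)"
    unfolding numerical_spectrum_eq_Inter[OF lin] by auto
  have "z \<in> numerical_resolvent_set (affine_op 0 A \<beta>)" if "z \<noteq> \<beta>" for z
  proof -
    define u where "u = sgn (z - \<beta>)"
    have u: "norm u = 1" using that by (simp add: u_def norm_sgn)
    have "u \<bullet> (z - \<beta>) = norm (z - \<beta>)"
      using that by (simp add: u_def sgn_div_norm dot_square_norm power2_eq_square)
    then have "u \<bullet> (z - \<beta>) > 0" using that by simp
    then have z: "u \<bullet> z > u \<bullet> \<beta>" by (simp add: inner_diff_right)
    have "numerical_halfspace u (u \<bullet> \<beta>) (affine_op 0 A \<beta>)"
      unfolding numerical_halfspace_def op fst_conv snd_conv diff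
    proof (intro allI impI conjI ballI)
      fix l assume l: "u \<bullet> l > u \<bullet> \<beta>"
      then have "l - \<beta> \<noteq> 0" by auto
      then show "bij (\<lambda>x::'a. (l - \<beta>) *\<^sub>C x)" by (rule bij_scaleC)
      fix x :: 'a
      have "u \<bullet> l - u \<bullet> \<beta> \<le> cmod (l - \<beta>)"
        using norm_cauchy_schwarz[of u "l - \<beta>"] u by (simp add: inner_diff_right)
      then show "(u \<bullet> l - u \<bullet> \<beta>) * norm x \<le> norm ((l - \<beta>) *\<^sub>C x)"
        by (simp add: norm_scaleC mult_right_mono)
    qed
    with u z show ?thesis unfolding numerical_resolvent_set_eq[OF lin] by blast
  qed
  with 1 show ?thesis by (auto simp: numerical_spectrum_def)
qed

section \<open>Isometric conjugation\<close>

lemma isometric_isomorphismD: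
  assumes "isometric_isomorphism U"
  shows "bij U" "norm (U x) = norm x" "U (x + y) = U x + U y" "U (c *\<^sub>C x) = c *\<^sub>C U x"
    "U 0 = 0"
proof -
  have L: "Vector_Spaces.linear scaleC scaleC U"
    using assms by (simp add: isometric_isomorphism_def)
  interpret U: Vector_Spaces.linear scaleC scaleC U by (rule L)
  show "bij U" "norm (U x) = norm x"
    using assms by (simp_all add: isometric_isomorphism_def)
  show "U (x + y) = U x + U y" by (rule U.add)
  show "U (c *\<^sub>C x) = c *\<^sub>C U x" by (rule U.scale)
  show "U 0 = 0" by (rule U.zero)
qed

lemma isometric_isomorphism_inv:
  assumes U: "isometric_isomorphism U"
  shows "isometric_isomorphism (inv U)"
proof -
  note D = isometric_isomorphismD[OF U]
  have UU: "U (inv U x) = x" "inv U (U x) = x" for x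
    using D(1) by (simp_all add: bij_is_surj surj_f_inv_f bij_is_inj)
  have "inv U (x + y) = inv U x + inv U y" for x y
    using UU D(3) by metis
  moreover have "inv U (c *\<^sub>C x) = c *\<^sub>C inv U x" for c x
    using UU D(4) by metis
  moreover have "norm (inv U x) = norm x" for x using UU D(2) by metis
  ultimately show ?thesis
    using D(1) unfolding isometric_isomorphism_def
    by (simp add: bij_imp_bij_inv Vector_Spaces.linear_iff complex_vector.vector_space_axioms)
qed

lemma linear_conjugate_op:
  assumes U: "isometric_isomorphism U" and A: "linear_op A"
  shows "linear_op (conjugate_op U A)"
  unfolding linear_op_def conjugate_op_def complex_vector.subspace_def
  by (simp add: isometric_isomorphismD[OF U]
      isometric_isomorphismD[OF isometric_isomorphism_inv[OF U]] linear_opD[OF A])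

text \<open>On the conjugated domain \<open>l - U\<^sup>-\<^sup>1AU = U\<^sup>-\<^sup>1(l - A)U\<close>, and isometries preserve the lower bound.\<close>

lemma numerical_halfspace_conjugate_op:
  assumes U: "isometric_isomorphism U" and H: "numerical_halfspace u \<omega> A"
  shows "numerical_halfspace u \<omega> (conjugate_op U A)"
  unfolding numerical_halfspace_def
proof (intro allI impI)
  fix l assume l: "u \<bullet> l > \<omega>"
  note D = isometric_isomorphismD[OF U]
  note I = isometric_isomorphismD[OF isometric_isomorphism_inv[OF U]]
  have UU: "inv U (U x) = x" for x using D(1) by (simp add: bij_is_inj)
  have bij: "bij_betw (\<lambda>x. l *\<^sub>C x - op_app A x) (op_dom A) UNIV"
    and bd: "\<And>x. x \<in> op_dom A \<Longrightarrow> (u \<bullet> l - \<omega>) * norm x \<le> norm (l *\<^sub>C x - op_app A x)"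
    using H l by (auto simp: numerical_halfspace_def)
  have eq: "l *\<^sub>C x - op_app (conjugate_op U A) x = inv U (l *\<^sub>C U x - op_app A (U x))" for x
    using I(3)[of "l *\<^sub>C U x - op_app A (U x)" "op_app A (U x)"] I(4)[of l "U x"] UU
    by (simp add: conjugate_op_def)
  have dom: "op_dom (conjugate_op U A) = U -` op_dom A" by (simp add: conjugate_op_def)
  have "bij_betw U (U -` op_dom A) (op_dom A)"
    using D(1) by (auto simp: bij_betw_def surj_image_vimage_eq intro: inj_on_subset)
  from bij_betw_trans[OF bij_betw_trans[OF this bij] I(1)]
  show "bij_betw (\<lambda>x. l *\<^sub>C x - op_app (conjugate_op U A) x) (op_dom (conjugate_op U A)) UNIV \<and>
    (\<forall>x\<in>op_dom (conjugate_op U A).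
      (u \<bullet> l - \<omega>) * norm x \<le> norm (l *\<^sub>C x - op_app (conjugate_op U A) x))"
    unfolding eq dom using bd[of "U _"] by (auto simp: o_def I(2) D(2))
qed

lemma conjugate_op_inv:
  assumes "bij U"
  shows "conjugate_op (inv U) (conjugate_op U A) = A"
  by (simp add: conjugate_op_def prod_eq_iff vimage_def inv_inv_eq[OF assms]
      surj_f_inv_f[OF bij_is_surj[OF assms]])

lemma numerical_spectrum_conjugate_op:
  assumes U: "isometric_isomorphism U" and A: "linear_op A"
  shows "numerical_spectrum (conjugate_op U A) = numerical_spectrum A"
proof -
  have "numerical_halfspace u \<omega> (conjugate_op U A) \<longleftrightarrow> numerical_halfspace u \<omega> A" for u \<omega>
    using numerical_halfspace_conjugate_op[OF U]
      numerical_halfspace_conjugate_op[OF isometric_isomorphism_inv[OF U], of u \<omega> "conjugate_op U A"]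
    unfolding conjugate_op_inv[OF isometric_isomorphismD(1)[OF U]] by blast
  then show ?thesis
    unfolding numerical_spectrum_eq_Inter[OF A]
      numerical_spectrum_eq_Inter[OF linear_conjugate_op[OF U A]] by simp
qed

theorem proposition2p3:
  fixes A :: "'a::complex_banach partial_op"
  assumes "closed_op A" and "densely_defined A"
  shows "(closed (numerical_spectrum A) \<and> convex (numerical_spectrum A)) \<and>
    (\<forall>\<alpha> \<beta>. numerical_spectrum (affine_op \<alpha> A \<beta>) = (\<lambda>z. \<alpha> * z + \<beta>) ` numerical_spectrum A) \<and>
    (\<forall>U. isometric_isomorphism U \<longrightarrow>
      numerical_spectrum A = numerical_spectrum (conjugate_op U A))"
proof -
  have A: "linear_op A" using assms(1) by (simp add: closed_op_def)
  have "numerical_spectrum (affine_op \<alpha> A \<beta>) = (\<lambda>z. \<alpha> * z + \<beta>) ` numerical_spectrum A"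
    for \<alpha> \<beta>
  proof (cases "\<alpha> = 0")
    case False
    then show ?thesis by (rule numerical_spectrum_affine_op[OF A])
  next
    case True
    show ?thesis
    proof (cases "\<exists>x::'a. x \<noteq> 0")
      case nontriv: True
      show ?thesis
        using numerical_spectrum_scalar[OF A nontriv]
          numerical_spectrum_nonempty[OF A assms(2) nontriv] \<open>\<alpha> = 0\<close> by auto
    next
      case False
      then show ?thesis
        using numerical_spectrum_trivial[OF A]
          numerical_spectrum_trivial[OF linear_affine_op[OF A]] by simp
    qed
  qed
  then show ?thesis
    using closed_numerical_spectrum[OF A] convex_numerical_spectrum[OF A]
      numerical_spectrum_conjugate_op[OF _ A] by simp
qed

end
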